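(* Let $n\ge5$. Then: (i) if $S$ is a regular $n$-dimensional simplex inscribed into $B_n$, there is no $1$-point of $B_n$ with respect to $S$; (ii) for every interpolation projector $P:C(B_n)\to\Pi_1(\mathbb{R}^n)$ with nodes at the vertices of a nondegenerate simplex contained in $B_n$, the equality $\|P\|_{B_n}=3-\frac{4}{n+1}$ does not hold; and consequently (iii) $\theta_n(B_n)>3-\frac{4}{n+1}$.
   Context: $B_n=\{x\in\mathbb{R}^n:\|x\|\le1\}$ is the Euclidean unit ball. $C(B_n)$ is the space of continuous functions $f:B_n\to\mathbb{R}$ with norm $\|f\|_{C(B_n)}=\max_{x\in B_n}|f(x)|$. $\Pi_1(\mathbb{R}^n)$ is the set of real polynomials in $n$ variables of degree at most $1$. For a nondegenerate $n$-dimensional simplex $S$ with vertices $x^{(1)},\dots,x^{(n+1)}\in B_n$, the interpolation projector $P:C(B_n)\to\Pi_1(\mathbb{R}^n)$ corresponding to $S$ is determined by $Pf(x^{(j)})=f(x^{(j)})$ for $1\le j\le n+1$. $\|P\|_{B_n}$ is the norm of $P$ as an operator from $C(B_n)$ to $C(B_n)$ (with $Pf$ restricted to $B_n$). $\theta_n(B_n)$ is the minimal value of $\|P\|_{B_n}$ over all interpolation projectors $P$ corresponding to nondegenerate simplices with vertices in $B_n$. The basic Lagrange polynomials $\lambda_1,\dots,\lambda_{n+1}\in\Pi_1(\mathbb{R}^n)$ of $S$ are determined by $\lambda_j(x^{(k)})=\delta_j^k$ (so $\lambda_j(x)$ are the barycentric coordinates of $x$ with respect to $S$). A point $x\in B_n$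 is a $1$-point of $B_n$ with respect to $S$ if, for the projector $P$ corresponding to $S$, $\|P\|_{B_n}=\sum_{j=1}^{n+1}|\lambda_j(x)|$ and exactly one of the numbers $\lambda_j(x)$ is negative. A simplex is inscribed into $B_n$ if all its vertices lie on the sphere $\|x\|=1$; it is regular if all its edges have equal length. *)

theory Defs
  imports "HOL-Analysis.Analysis"
begin

definition unit_ball :: "(real ^ 'n) set" where
  "unit_ball = cball 0 1"

text \<open>Elements of \<open>C(B\<^sub>n)\<close> are represented by functions on the whole space that are
  continuous on the ball; everything below depends only on their values on the ball, up to
  which they are determined.\<close>

definition cont_ball :: "(real ^ 'n \<Rightarrow> real) set" where
  "cont_ball = {f. continuous_on unit_ball f}"

definition norm_ball :: "(real ^ 'n \<Rightarrow> real) \<Rightarrow> real" where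
  "norm_ball f = (SUP x\<in>unit_ball. \<bar>f x\<bar>)"

definition affine_polys :: "(real ^ 'n \<Rightarrow> real) set" where
  "affine_polys = {p. \<exists>a c. p = (\<lambda>x. a \<bullet> x + c)}"

definition op_norm_ball :: "((real ^ 'n \<Rightarrow> real) \<Rightarrow> (real ^ 'n \<Rightarrow> real)) \<Rightarrow> real" where
  "op_norm_ball P = (SUP f\<in>{f \<in> cont_ball. norm_ball f \<le> 1}. norm_ball (P f))"

definition nondegenerate_simplex :: "(real ^ 'n) set \<Rightarrow> bool" where
  "nondegenerate_simplex S \<longleftrightarrow> int CARD('n) simplex S"

definition vertices :: "(real ^ 'n) set \<Rightarrow> (real ^ 'n) set" where
  "vertices S = {v. v extreme_point_of S}"

definition inscribed_in_ball :: "(real ^ 'n) set \<Rightarrow> bool" where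
  "inscribed_in_ball S \<longleftrightarrow> vertices S \<subseteq> sphere 0 1"

definition regular_simplex :: "(real ^ 'n) set \<Rightarrow> bool" where
  "regular_simplex S \<longleftrightarrow> nondegenerate_simplex S \<and>
     (\<exists>d. \<forall>u\<in>vertices S. \<forall>v\<in>vertices S. u \<noteq> v \<longrightarrow> dist u v = d)"

text \<open>Only the values of \<open>P\<close> on \<open>C(B\<^sub>n)\<close> are constrained; there they are uniquely
  determined by \<open>S\<close> (see \<open>affine_interpolation_unique\<close>).\<close>

definition interpolation_projector ::
    "(real ^ 'n) set \<Rightarrow> ((real ^ 'n \<Rightarrow> real) \<Rightarrow> (real ^ 'n \<Rightarrow> real)) \<Rightarrow> bool" where
  "interpolation_projector S P \<longleftrightarrow>
     nondegenerate_simplex S \<and> vertices S \<subseteq> unit_ball \<and>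
     (\<forall>f\<in>cont_ball. P f \<in> affine_polys \<and> (\<forall>v\<in>vertices S. P f v = f v))"

text \<open>The minimum over all projectors, written as an infimum of a nonempty set of nonnegative
  reals. It is attained (the norm tends to infinity as the simplex degenerates), but the
  definition does not presuppose this.\<close>

definition min_projector_norm :: "'n::finite itself \<Rightarrow> real" where
  "min_projector_norm _ =
     Inf {op_norm_ball P | (S :: (real ^ 'n) set) P. interpolation_projector S P}"

text \<open>The basic Lagrange polynomials are indexed by the vertices themselves.\<close>

definition lagrange :: "(real ^ 'n) set \<Rightarrow> real ^ 'n \<Rightarrow> (real ^ 'n \<Rightarrow> real)" where
  "lagrange S v = (THE p. p \<in> affine_polys \<and>
     (\<forall>w\<in>vertices S. p w = (if w = v then 1 else 0)))"

definition one_point :: "(real ^ 'n) set \<Rightarrow> real ^ 'n \<Rightarrow> bool" where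
  "one_point S x \<longleftrightarrow> x \<in> unit_ball \<and>
     (\<exists>P. interpolation_projector S P \<and>
          op_norm_ball P = (\<Sum>v\<in>vertices S. \<bar>lagrange S v x\<bar>)) \<and>
     (\<exists>!v. v \<in> vertices S \<and> lagrange S v x < 0)"

lemma vertices_simplex:
  fixes S :: "(real ^ 'n) set"
  assumes "nondegenerate_simplex S"
  shows "\<not> affine_dependent (vertices S)" "finite (vertices S)"
    "card (vertices S) = CARD('n) + 1" "S = convex hull (vertices S)"
proof -
  obtain C where C: "\<not> affine_dependent C" "int (card C) = int CARD('n) + 1" "S = convex hull C"
    using assms unfolding nondegenerate_simplex_def simplex_def by blast
  have "vertices S = C"
    using extreme_point_of_convex_hull_affine_independent[OF C(1)] C(3)
    by (auto simp: vertices_def)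
  then show "\<not> affine_dependent (vertices S)" "finite (vertices S)"
    "card (vertices S) = CARD('n) + 1" "S = convex hull (vertices S)"
    using C aff_independent_finite by auto
qed

lemma affine_interpolation_unique:
  fixes S :: "(real ^ 'n) set" and f :: "real ^ 'n \<Rightarrow> real"
  assumes "nondegenerate_simplex S"
  shows "\<exists>!p. p \<in> affine_polys \<and> (\<forall>v\<in>vertices S. p v = f v)"
proof -
  define V where "V = vertices S"
  note V = vertices_simplex[OF assms, folded V_def]
  obtain v where v: "v \<in> V" using V(3) by fastforce
  define B where "B = (\<lambda>x. x - v) ` (V - {v})"
  have indep: "independent B"
    using affine_dependent_iff_dependent2[OF v] V(1) by (simp add: B_def)
  obtain g where g: "linear g" "\<And>b. b \<in> B \<Longrightarrow> g b = f (b + v) - f v"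
    using linear_independent_extend[OF indep, of "\<lambda>b. f (b + v) - f v"] by blast
  define a where "a = adjoint g 1"
  have ga: "g x = a \<bullet> x" for x
    using adjoint_works[OF g(1), of x 1] by (simp add: a_def inner_commute)
  define p where "p = (\<lambda>x. a \<bullet> x + (f v - a \<bullet> v))"
  have p1: "p \<in> affine_polys" unfolding affine_polys_def p_def by blast
  have p2: "p w = f w" if "w \<in> V" for w
  proof (cases "w = v")
    case False
    then have "w - v \<in> B" using that by (auto simp: B_def)
    then have "a \<bullet> (w - v) = f w - f v" using g(2) ga by force
    then show ?thesis by (simp add: p_def inner_diff_right)
  qed (simp add: p_def)
  have hull: "affine hull V = UNIV"
  proof -
    have "aff_dim V = DIM(real ^ 'n)"
      using aff_dim_affine_independent[OF V(1)] V(3) by simp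
    then show ?thesis using aff_dim_eq_full by blast
  qed
  have uniq: "q = p" if q: "q \<in> affine_polys" "\<forall>w\<in>V. q w = f w" for q
  proof -
    obtain b c where qb: "q = (\<lambda>x. b \<bullet> x + c)" using q(1) by (auto simp: affine_polys_def)
    let ?H = "{x. (b - a) \<bullet> x = f v - a \<bullet> v - c}"
    have "V \<subseteq> ?H" using q(2) p2 by (auto simp: qb p_def inner_diff_left algebra_simps)
    then have "affine hull V \<subseteq> ?H" by (rule hull_minimal) (rule affine_hyperplane)
    then show ?thesis
      by (auto simp: hull qb p_def inner_diff_left fun_eq_iff algebra_simps)
  qed
  show ?thesis
    using p1 p2 uniq unfolding V_def by blast
qed

text \<open>The supremum defining the operator norm is over a set bounded above, so it is not
  an artefact of the totality of real suprema.\<close>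

lemma bdd_above_op_norm_ball:
  fixes S :: "(real ^ 'n) set"
  assumes P: "interpolation_projector S P"
  shows "bdd_above ((\<lambda>f. norm_ball (P f)) ` {f \<in> cont_ball. norm_ball f \<le> 1})"
proof -
  have S: "nondegenerate_simplex S" and sub: "vertices S \<subseteq> unit_ball"
    using P by (auto simp: interpolation_projector_def)
  define l where "l = lagrange S"
  have l: "l v \<in> affine_polys" "\<And>w. w \<in> vertices S \<Longrightarrow> l v w = (if w = v then 1 else 0)" for v
    using theI'[OF affine_interpolation_unique[OF S, of "\<lambda>w. if w = v then 1 else 0"]]
    by (auto simp: l_def lagrange_def)
  have "\<exists>m. \<forall>x\<in>unit_ball. \<bar>l v x\<bar> \<le> m" for v
  proof -
    obtain a c where ac: "l v = (\<lambda>x. a \<bullet> x + c)" using l(1)[of v] by (auto simp: affine_polys_def)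
    have "\<bar>l v x\<bar> \<le> norm a + \<bar>c\<bar>" if "x \<in> unit_ball" for x
    proof -
      have "\<bar>a \<bullet> x\<bar> \<le> norm a * norm x" by (rule Cauchy_Schwarz_ineq2)
      also have "\<dots> \<le> norm a" using that by (simp add: unit_ball_def mult_left_le)
      finally show ?thesis by (simp add: ac)
    qed
    then show ?thesis by blast
  qed
  then obtain m where m: "\<And>v x. x \<in> unit_ball \<Longrightarrow> \<bar>l v x\<bar> \<le> m v" by metis
  have "norm_ball (P f) \<le> (\<Sum>v\<in>vertices S. m v)" if f: "f \<in> cont_ball" "norm_ball f \<le> 1" for f
  proof -
    have fb: "\<bar>f x\<bar> \<le> 1" if "x \<in> unit_ball" for x
    proof -
      have "compact ((\<lambda>x. \<bar>f x\<bar>) ` unit_ball)"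
        using f(1) by (intro compact_continuous_image continuous_intros)
          (auto simp: cont_ball_def unit_ball_def)
      then have "bdd_above ((\<lambda>x. \<bar>f x\<bar>) ` unit_ball)"
        by (intro bounded_imp_bdd_above compact_imp_bounded)
      then have "\<bar>f x\<bar> \<le> norm_ball f"
        unfolding norm_ball_def using that by (rule cSUP_upper2) simp
      with f(2) show ?thesis by linarith
    qed
    define q where "q = (\<lambda>x. \<Sum>v\<in>vertices S. f v * l v x)"
    obtain a c where ac: "\<And>v. l v = (\<lambda>x. a v \<bullet> x + c v)"
      using l(1) unfolding affine_polys_def by simp metis
    have "q = (\<lambda>x. (\<Sum>v\<in>vertices S. f v *\<^sub>R a v) \<bullet> x + (\<Sum>v\<in>vertices S. f v * c v))"
      by (simp add: q_def ac inner_sum_left sum.distrib algebra_simps)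
    then have "q \<in> affine_polys" unfolding affine_polys_def by blast
    moreover have "q w = f w" if "w \<in> vertices S" for w
      using that vertices_simplex(2)[OF S] by (simp add: q_def l(2) if_distrib sum.delta cong: if_cong)
    ultimately have "P f = q"
      using affine_interpolation_unique[OF S, of f] P f(1)
      unfolding interpolation_projector_def by blast
    have "\<bar>P f x\<bar> \<le> (\<Sum>v\<in>vertices S. m v)" if x: "x \<in> unit_ball" for x
    proof -
      have "\<bar>P f x\<bar> \<le> (\<Sum>v\<in>vertices S. \<bar>f v * l v x\<bar>)"
        unfolding \<open>P f = q\<close> q_def by (rule sum_abs)
      also have "\<dots> \<le> (\<Sum>v\<in>vertices S. m v)"
      proof (rule sum_mono)
        fix v assume "v \<in> vertices S"
        then have "\<bar>f v\<bar> \<le> 1" using fb sub by blast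
        then have "\<bar>f v * l v x\<bar> \<le> 1 * m v"
          unfolding abs_mult using m[OF x] by (intro mult_mono) auto
        then show "\<bar>f v * l v x\<bar> \<le> m v" by simp
      qed
      finally show ?thesis .
    qed
    moreover have "unit_ball \<noteq> ({} :: (real ^ 'n) set)" by (simp add: unit_ball_def)
    ultimately show ?thesis unfolding norm_ball_def by (intro cSUP_least)
  qed
  then show ?thesis by (intro bdd_aboveI2[where M = "\<Sum>v\<in>vertices S. m v"]) auto
qed

end

theory Submission
  imports Defs
begin

text \<open>Write the Lagrange polynomials of a simplex with vertex set \<open>V\<close> as
  \<open>\<lambda>\<^sub>v(x) = a\<^sub>v \<bullet> x + c\<^sub>v\<close> and put \<open>m = (n - 1)/(n + 1)\<close>, so that the critical value is
  \<open>3 - 4/(n + 1) = 1 + 2m\<close>.  Feeding the projector a continuous function equal to \<open>-1\<close> on a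
  set \<open>A\<close> of vertices and to \<open>1\<close> on the others, and evaluating at the point of the ball
  opposite to \<open>\<Sum>\<^bsub>v \<in> A\<^esub> a\<^sub>v\<close>, gives
  \<open>\<parallel>P\<parallel> \<ge> 1 + 2(\<parallel>\<Sum>\<^bsub>v \<in> A\<^esub> a\<^sub>v\<parallel> - \<Sum>\<^bsub>v \<in> A\<^esub> c\<^sub>v)\<close>.

  For singletons \<open>A\<close> this bounds \<open>\<parallel>a\<^sub>v\<parallel> - c\<^sub>v\<close> from above, while \<open>\<parallel>a\<^sub>v\<parallel> \<ge> a\<^sub>v \<bullet> v = 1 - c\<^sub>v\<close>;
  as the \<open>c\<^sub>v\<close> add up to \<open>1\<close>, a norm equal to \<open>1 + 2m\<close> forces \<open>c\<^sub>v = 1/(n + 1)\<close> and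
  \<open>a\<^sub>v = n/(n + 1) v\<close> with \<open>\<parallel>v\<parallel> = 1\<close>, which is the regular inscribed simplex.  But then a
  pair \<open>A = {v, w}\<close> has \<open>\<parallel>a\<^sub>v + a\<^sub>w\<parallel>\<^sup>2 = 2n(n - 1)/(n + 1)\<^sup>2\<close>, and this exceeds \<open>1\<close> as soon as
  \<open>n\<^sup>2 - 4n - 1 > 0\<close>, that is for \<open>n \<ge> 5\<close>; the pair inequality then pushes the norm
  strictly above \<open>1 + 2m\<close>.

  The infimum over all projectors is handled without compactness: the same argument is run
  with a slack \<open>\<delta>\<close>, all errors being explicit functions of \<open>n\<close> and \<open>\<delta>\<close> that vanish with
  \<open>\<delta>\<close>.  This yields one \<open>\<delta> > 0\<close> with \<open>\<parallel>P\<parallel> > 1 + 2(m + \<delta>)\<close> for every projector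
  (\<open>projector_norm_gap\<close>), hence both statements about norms.  For a regular
  inscribed simplex \<open>\<lambda>\<^sub>v\<close> is explicit and at least \<open>-m\<close> on the ball, so a
  \<open>1\<close>-point would give \<open>\<parallel>P\<parallel> \<le> 1 + 2m\<close>, contradicting the gap.\<close>

section \<open>Lagrange polynomials and the operator norm\<close>

lemma lagrange:
  fixes S :: "(real ^ 'n) set"
  assumes "nondegenerate_simplex S"
  shows "lagrange S v \<in> affine_polys"
    and "w \<in> vertices S \<Longrightarrow> lagrange S v w = (if w = v then 1 else 0)"
  using theI'[OF affine_interpolation_unique[OF assms, of "\<lambda>w. if w = v then 1 else 0"]]
  by (auto simp: lagrange_def)

lemma affine_poly_eq_lagrange_sum:
  fixes S :: "(real ^ 'n) set"
  assumes S: "nondegenerate_simplex S" and p: "p \<in> affine_polys"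
  shows "p x = (\<Sum>v\<in>vertices S. p v * lagrange S v x)"
proof -
  define q where "q = (\<lambda>x. \<Sum>v\<in>vertices S. p v * lagrange S v x)"
  have "\<forall>v. \<exists>b k. lagrange S v = (\<lambda>x. b \<bullet> x + k)"
    using lagrange(1)[OF S] by (simp add: affine_polys_def)
  then obtain a c where ac: "\<And>v. lagrange S v = (\<lambda>x. a v \<bullet> x + c v)"
    by metis
  have "q = (\<lambda>x. (\<Sum>v\<in>vertices S. p v *\<^sub>R a v) \<bullet> x + (\<Sum>v\<in>vertices S. p v * c v))"
    by (simp add: q_def ac inner_sum_left sum.distrib algebra_simps)
  then have "q \<in> affine_polys" unfolding affine_polys_def by blast
  moreover have "q w = p w" if "w \<in> vertices S" for w
    using that vertices_simplex(2)[OF S]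
    by (simp add: q_def lagrange(2)[OF S] if_distrib sum.delta cong: if_cong)
  ultimately have "p = q"
    using affine_interpolation_unique[OF S, of p] p by blast
  then show ?thesis unfolding q_def by metis
qed

lemma sum_lagrange:
  fixes S :: "(real ^ 'n) set"
  assumes "nondegenerate_simplex S"
  shows "(\<Sum>v\<in>vertices S. lagrange S v x) = 1"
proof -
  have "(\<lambda>x. 1) \<in> (affine_polys :: (real ^ 'n \<Rightarrow> real) set)"
    unfolding affine_polys_def by (intro CollectI exI[of _ 0] exI[of _ 1]) simp
  from affine_poly_eq_lagrange_sum[OF assms this, of x] show ?thesis by simp
qed

lemma abs_le_norm_ball:
  fixes f :: "real ^ 'n \<Rightarrow> real"
  assumes "f \<in> cont_ball" "x \<in> unit_ball"
  shows "\<bar>f x\<bar> \<le> norm_ball f"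
proof -
  have "compact ((\<lambda>x. \<bar>f x\<bar>) ` unit_ball)"
    using assms(1) by (intro compact_continuous_image continuous_intros)
      (auto simp: cont_ball_def unit_ball_def)
  then have "bdd_above ((\<lambda>x. \<bar>f x\<bar>) ` unit_ball)"
    by (intro bounded_imp_bdd_above compact_imp_bounded)
  then show ?thesis
    unfolding norm_ball_def using assms(2) by (rule cSUP_upper2) simp
qed

lemma affine_polys_subset_cont_ball: "affine_polys \<subseteq> cont_ball"
  by (auto simp: affine_polys_def cont_ball_def intro!: continuous_intros)

text \<open>The test function takes the value \<open>-1\<close> on \<open>A\<close> and \<open>1\<close> on the remaining vertices; it
  exists by Urysohn's lemma, since finite sets are closed.\<close>

lemma op_norm_ball_ge:
  fixes S :: "(real ^ 'n) set"
  assumes P: "interpolation_projector S P" and A: "A \<subseteq> vertices S" and x: "x \<in> unit_ball"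
  shows "1 - 2 * (\<Sum>v\<in>A. lagrange S v x) \<le> op_norm_ball P"
proof -
  let ?V = "vertices S"
  have S: "nondegenerate_simplex S"
    using P by (auto simp: interpolation_projector_def)
  have fin: "finite ?V" by (rule vertices_simplex(2)[OF S])
  have "closed A" "closed (?V - A)"
    using fin A by (auto intro: finite_imp_closed finite_subset)
  then obtain f :: "real ^ 'n \<Rightarrow> real" where f: "continuous_on UNIV f"
    "\<And>x. f x \<in> closed_segment (-1) 1"
    "\<And>x. x \<in> A \<Longrightarrow> f x = -1" "\<And>x. x \<in> ?V - A \<Longrightarrow> f x = 1"
    by (rule Urysohn[of A "?V - A" "-1::real" 1]) auto
  have fc: "f \<in> cont_ball"
    using f(1) continuous_on_subset by (auto simp: cont_ball_def)
  have "\<bar>f x\<bar> \<le> 1" for x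
    using f(2)[of x] by (auto simp: closed_segment_eq_real_ivl)
  then have fn: "norm_ball f \<le> 1"
    unfolding norm_ball_def by (intro cSUP_least) (auto simp: unit_ball_def)
  have Pf: "P f \<in> affine_polys" "\<And>v. v \<in> ?V \<Longrightarrow> P f v = f v"
    using P fc by (auto simp: interpolation_projector_def)
  have "P f x = (\<Sum>v\<in>?V. f v * lagrange S v x)"
    using affine_poly_eq_lagrange_sum[OF S Pf(1), of x] Pf(2) by simp
  also have "\<dots> = (\<Sum>v\<in>?V - A. f v * lagrange S v x) + (\<Sum>v\<in>A. f v * lagrange S v x)"
    by (rule sum.subset_diff[OF A fin])
  also have "\<dots> = (\<Sum>v\<in>?V - A. lagrange S v x) - (\<Sum>v\<in>A. lagrange S v x)"
    using f(3,4) by (simp add: sum_negf)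
  also have "\<dots> = 1 - 2 * (\<Sum>v\<in>A. lagrange S v x)"
    using sum.subset_diff[OF A fin, of "\<lambda>v. lagrange S v x"] sum_lagrange[OF S, of x] by simp
  finally have "1 - 2 * (\<Sum>v\<in>A. lagrange S v x) \<le> \<bar>P f x\<bar>" by simp
  also have "\<dots> \<le> norm_ball (P f)"
    using Pf(1) affine_polys_subset_cont_ball x by (intro abs_le_norm_ball) auto
  also have "\<dots> \<le> op_norm_ball P"
    unfolding op_norm_ball_def
    using bdd_above_op_norm_ball[OF P] fc fn by (intro cSUP_upper) auto
  finally show ?thesis .
qed

text \<open>The best point for a given \<open>A\<close> is the unit vector opposite to the gradient of
  \<open>\<Sum>\<^bsub>v \<in> A\<^esub> \<lambda>\<^sub>v\<close>; with \<open>sgn 0 = 0\<close> the case of a zero gradient is covered.\<close>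

lemma op_norm_ball_ge_gradient:
  fixes S :: "(real ^ 'n) set"
  assumes P: "interpolation_projector S P" and A: "A \<subseteq> vertices S"
    and ac: "\<And>v. lagrange S v = (\<lambda>x. a v \<bullet> x + c v)"
  shows "1 + 2 * (norm (\<Sum>v\<in>A. a v) - (\<Sum>v\<in>A. c v)) \<le> op_norm_ball P"
proof -
  let ?s = "\<Sum>v\<in>A. a v"
  have "- sgn ?s \<in> unit_ball" by (simp add: unit_ball_def norm_sgn)
  from op_norm_ball_ge[OF P A this]
  have "1 - 2 * ((\<Sum>v\<in>A. c v) - ?s \<bullet> sgn ?s) \<le> op_norm_ball P"
    by (simp add: ac sum_subtractf inner_sum_left)
  moreover have "?s \<bullet> sgn ?s = norm ?s"
    by (cases "?s = 0") (simp_all add: sgn_div_norm dot_square_norm power2_eq_square)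
  ultimately show ?thesis by simp
qed

section \<open>A uniform gap above the critical value\<close>

text \<open>For \<open>\<delta> = 0\<close> the inequality reads \<open>4m\<^sup>2 > 2(n - 1)/n\<close>, which is equivalent to
  \<open>n\<^sup>2 - 4n - 1 > 0\<close>; it persists for small \<open>\<delta>\<close> by continuity.\<close>

lemma small_slack_exists:
  fixes n :: real
  assumes n: "n \<ge> 5"
  defines "m \<equiv> (n - 1) / (n + 1)" and "t \<equiv> n / (n + 1)"
  obtains \<delta> where "\<delta> > 0" "m - n * \<delta> > 0"
    "(2 * (m - n * \<delta>))\<^sup>2 > (1 + (n + 1) * \<delta>)\<^sup>2 *
       (2 + 2 / t * (- 1 / (n + 1) + \<delta> / 2 +
          sqrt (t\<^sup>2 - 2 * t * (t - n * \<delta> / 2) + (t + (n / 2 + 1) * \<delta>)\<^sup>2)))"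
proof -
  define g where "g = (\<lambda>\<delta>. (2 * (m - n * \<delta>))\<^sup>2 - (1 + (n + 1) * \<delta>)\<^sup>2 *
       (2 + 2 / t * (- 1 / (n + 1) + \<delta> / 2 +
          sqrt (t\<^sup>2 - 2 * t * (t - n * \<delta> / 2) + (t + (n / 2 + 1) * \<delta>)\<^sup>2))))"
  have "t > 0" "m > 0" using n by (auto simp: t_def m_def)
  have "isCont g 0"
    unfolding g_def by (intro continuous_intros) (use \<open>t > 0\<close> in auto)
  then have "g \<midarrow>0\<rightarrow> g 0" by (simp add: isCont_def)
  then have ev: "(g \<longlongrightarrow> g 0) (at_right 0)"
    by (rule filterlim_mono) (auto simp: at_within_le_at)
  have "t\<^sup>2 - 2 * t * t + t\<^sup>2 = 0" by (simp add: power2_eq_square)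
  moreover have "2 / t * (- 1 / (n + 1)) = - (2 / n)"
    using n by (simp add: t_def divide_simps)
  ultimately have "g 0 = 4 * m\<^sup>2 - (2 - 2 / n)"
    unfolding g_def by (simp add: power_mult_distrib)
  also have "\<dots> = 2 * (n - 1) * (n\<^sup>2 - 4 * n - 1) / (n * (n + 1)\<^sup>2)"
    using n by (simp add: m_def power_divide divide_simps) (simp add: power2_eq_square algebra_simps)
  also have "\<dots> > 0"
  proof -
    have "n * n \<ge> 5 * n" using n by simp
    then have "n\<^sup>2 - 4 * n - 1 > 0" using n unfolding power2_eq_square by linarith
    then show ?thesis using n by simp
  qed
  finally have "g 0 > 0" .
  then have 1: "\<forall>\<^sub>F \<delta> in at_right 0. g \<delta> > 0"
    using order_tendstoD(1)[OF ev] by blast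
  have "((\<lambda>\<delta>. m - n * \<delta>) \<longlongrightarrow> m - n * 0) (at_right 0)"
    by (intro tendsto_intros)
  then have 2: "\<forall>\<^sub>F \<delta> in at_right 0. m - n * \<delta> > 0"
    using order_tendstoD(1) \<open>m > 0\<close> by fastforce
  have 3: "\<forall>\<^sub>F \<delta> in at_right (0::real). \<delta> > 0"
    by (rule eventually_at_right_less)
  from 1 2 3 have "\<forall>\<^sub>F \<delta> in at_right 0. \<delta> > 0 \<and> m - n * \<delta> > 0 \<and> g \<delta> > 0"
    by eventually_elim auto
  then obtain \<delta> where "\<delta> > 0" "m - n * \<delta> > 0" "g \<delta> > 0"
    using eventually_happens trivial_limit_at_right_real by blast
  then show thesis using that by (simp add: g_def)
qed

text \<open>An upper bound \<open>m + \<delta>\<close> for every \<open>\<parallel>a\<^sub>v\<parallel> - c\<^sub>v\<close> squeezes the constant terms towards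
  \<open>1/(n + 1)\<close>: from below because \<open>1 - c\<^sub>v = a\<^sub>v \<bullet> v \<le> \<parallel>a\<^sub>v\<parallel>\<close>, and from above because
  the terms add up to \<open>1\<close>.\<close>

lemma constant_terms_nearly_equal:
  fixes a :: "'a::euclidean_space \<Rightarrow> 'a" and c :: "'a \<Rightarrow> real" and n :: nat
  assumes V: "finite V" "card V = n + 1" "V \<subseteq> cball 0 1"
    and diag: "\<And>v. v \<in> V \<Longrightarrow> a v \<bullet> v + c v = 1"
    and csum: "(\<Sum>v\<in>V. c v) = 1"
    and single: "\<And>v. v \<in> V \<Longrightarrow> norm (a v) - c v \<le> (real n - 1) / (real n + 1) + \<delta>"
    and v: "v \<in> V"
  shows "c v \<ge> 1 / (real n + 1) - \<delta> / 2" "c v \<le> 1 / (real n + 1) + real n * \<delta> / 2"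
proof -
  have half: "1 - (real n - 1) / (real n + 1) = 2 * (1 / (real n + 1))"
    by (simp add: field_simps)
  have lower: "c w \<ge> 1 / (real n + 1) - \<delta> / 2" if w: "w \<in> V" for w
  proof -
    have "a w \<bullet> w \<le> norm (a w) * norm w" by (rule norm_cauchy_schwarz)
    also have "\<dots> \<le> norm (a w)" using V(3) w by (auto intro!: mult_left_le)
    finally show ?thesis using diag[OF w] single[OF w] half by linarith
  qed
  then show "c v \<ge> 1 / (real n + 1) - \<delta> / 2" using v .
  have "(\<Sum>w\<in>V - {v}. c w) \<ge> (\<Sum>w\<in>V - {v}. 1 / (real n + 1) - \<delta> / 2)"
    by (intro sum_mono lower) auto
  also have "(\<Sum>w\<in>V - {v}. 1 / (real n + 1) - \<delta> / 2) = real n * (1 / (real n + 1) - \<delta> / 2)"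
    using V v by simp
  finally have "c v \<le> 1 - real n * (1 / (real n + 1) - \<delta> / 2)"
    using csum sum.remove[OF V(1) v, of c] by simp
  also have "\<dots> = 1 / (real n + 1) + real n * \<delta> / 2"
    by (simp add: field_simps)
  finally show "c v \<le> 1 / (real n + 1) + real n * \<delta> / 2" .
qed

text \<open>Near-equality makes \<open>a\<^sub>v\<close> nearly equal to \<open>t v\<close> with \<open>t = n/(n + 1)\<close>, so \<open>t v \<bullet> w\<close> is at
  most about \<open>a\<^sub>v \<bullet> w = -c\<^sub>v\<close>, which bounds \<open>\<parallel>v + w\<parallel>\<close>.  The bound on \<open>\<parallel>a\<^sub>v + a\<^sub>w\<parallel>\<close> then comes
  from Cauchy-Schwarz applied to \<open>(a\<^sub>v + a\<^sub>w) \<bullet> (v + w) = 2(1 - c\<^sub>v - c\<^sub>w)\<close>.\<close>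

lemma pair_bound:
  fixes a b v w :: "'a::euclidean_space" and n c d \<delta> :: real
  assumes n: "n > 0" and \<delta>: "\<delta> > 0"
    and ball: "norm v \<le> 1" "norm w \<le> 1"
    and dual: "a \<bullet> v = 1 - c" "a \<bullet> w = - c" "b \<bullet> v = - d" "b \<bullet> w = 1 - d"
    and c: "c \<ge> 1 / (n + 1) - \<delta> / 2" "c \<le> 1 / (n + 1) + n * \<delta> / 2"
    and d: "d \<le> 1 / (n + 1) + n * \<delta> / 2"
    and single: "norm a - c \<le> (n - 1) / (n + 1) + \<delta>"
    and pair: "norm (a + b) - (c + d) \<le> (n - 1) / (n + 1) + \<delta>"
    and pos: "(n - 1) / (n + 1) - n * \<delta> > 0"
  defines "t \<equiv> n / (n + 1)"
  shows "(2 * ((n - 1) / (n + 1) - n * \<delta>))\<^sup>2 \<le> (1 + (n + 1) * \<delta>)\<^sup>2 *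
       (2 + 2 / t * (- 1 / (n + 1) + \<delta> / 2 +
          sqrt (t\<^sup>2 - 2 * t * (t - n * \<delta> / 2) + (t + (n / 2 + 1) * \<delta>)\<^sup>2)))"
proof -
  define e where "e = t\<^sup>2 - 2 * t * (t - n * \<delta> / 2) + (t + (n / 2 + 1) * \<delta>)\<^sup>2"
  define m where "m = (n - 1) / (n + 1)"
  have t: "t > 0" using n by (simp add: t_def)
  have mt: "m + 1 / (n + 1) = t" "m + 2 / (n + 1) = 1" "1 - 1 / (n + 1) = t"
    using n by (simp_all add: m_def t_def add_divide_distrib[symmetric] divide_simps)
  have na: "norm a \<le> t + (n / 2 + 1) * \<delta>"
    using single c(2) mt(1) unfolding m_def[symmetric] by (simp add: algebra_simps)
  have "(norm (t *\<^sub>R v - a))\<^sup>2 = t\<^sup>2 * (norm v)\<^sup>2 - 2 * t * (1 - c) + (norm a)\<^sup>2"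
    by (simp add: power2_norm_eq_inner inner_diff_left inner_diff_right dual inner_commute[of v a]
        power2_eq_square[of t] algebra_simps)
  also have "\<dots> \<le> e"
  proof -
    have "t\<^sup>2 * (norm v)\<^sup>2 \<le> t\<^sup>2"
      using ball(1) by (intro mult_left_le) (auto simp: power_le_one)
    moreover have "2 * t * (t - n * \<delta> / 2) \<le> 2 * t * (1 - c)"
      using c(2) mt(3) t by (intro mult_left_mono) auto
    moreover have "(norm a)\<^sup>2 \<le> (t + (n / 2 + 1) * \<delta>)\<^sup>2"
      using na by (intro power_mono) auto
    ultimately show ?thesis unfolding e_def by linarith
  qed
  finally have close: "norm (t *\<^sub>R v - a) \<le> sqrt e" by (rule real_le_rsqrt)
  have "(t *\<^sub>R v - a) \<bullet> w \<le> norm (t *\<^sub>R v - a) * norm w" by (rule norm_cauchy_schwarz)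
  also have "\<dots> \<le> sqrt e"
    using close ball(2) by (meson mult_left_le norm_ge_zero order_trans)
  finally have "t * (v \<bullet> w) \<le> - c + sqrt e"
    by (simp add: inner_diff_left dual)
  also have "\<dots> \<le> - 1 / (n + 1) + \<delta> / 2 + sqrt e" using c(1) by simp
  finally have vw: "v \<bullet> w \<le> (- 1 / (n + 1) + \<delta> / 2 + sqrt e) / t"
    using t by (simp add: pos_le_divide_eq mult.commute)
  have "(norm (v + w))\<^sup>2 = (norm v)\<^sup>2 + (norm w)\<^sup>2 + 2 * (v \<bullet> w)"
    by (simp add: power2_norm_eq_inner inner_add_left inner_add_right inner_commute)
  also have "\<dots> \<le> 2 + 2 / t * (- 1 / (n + 1) + \<delta> / 2 + sqrt e)"
  proof -
    have rearrange: "2 / t * y = 2 * (y / t)" for y :: real by simp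
    show ?thesis
      using vw power_le_one[OF norm_ge_zero ball(1), of 2]
        power_le_one[OF norm_ge_zero ball(2), of 2]
      unfolding rearrange by linarith
  qed
  finally have sum_bound: "(norm (v + w))\<^sup>2 \<le> 2 + 2 / t * (- 1 / (n + 1) + \<delta> / 2 + sqrt e)" .
  have cd: "c + d \<le> 2 / (n + 1) + n * \<delta>" using c(2) d by simp
  have "norm (a + b) \<le> m + \<delta> + (c + d)" using pair by (simp add: m_def)
  also have "\<dots> \<le> 1 + (n + 1) * \<delta>" using cd mt(2) by (simp add: algebra_simps)
  finally have nab: "norm (a + b) \<le> 1 + (n + 1) * \<delta>" .
  have "2 * (m - n * \<delta>) \<le> (a + b) \<bullet> (v + w)"
    using cd mt(2) by (simp add: inner_add_left inner_add_right dual)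
  also have "\<dots> \<le> norm (a + b) * norm (v + w)" by (rule norm_cauchy_schwarz)
  finally have "(2 * (m - n * \<delta>))\<^sup>2 \<le> (norm (a + b) * norm (v + w))\<^sup>2"
    using pos unfolding m_def[symmetric] by (intro power_mono) auto
  also have "\<dots> = (norm (a + b))\<^sup>2 * (norm (v + w))\<^sup>2" by (rule power_mult_distrib)
  also have "\<dots> \<le> (1 + (n + 1) * \<delta>)\<^sup>2 * (2 + 2 / t * (- 1 / (n + 1) + \<delta> / 2 + sqrt e))"
    using nab sum_bound by (intro mult_mono power_mono) auto
  finally show ?thesis unfolding e_def m_def .
qed

text \<open>A single pair of vertices suffices: if the norm were at most \<open>1 + 2(m + \<delta>)\<close>, the
  conclusion of \<open>pair_bound\<close> would contradict the choice of \<open>\<delta>\<close>, which depends on \<open>n\<close>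
  only.\<close>

theorem projector_norm_gap:
  assumes "CARD('n::finite) \<ge> 5"
  obtains \<epsilon> where "\<epsilon> > 0"
    "\<And>(S :: (real ^ 'n) set) P. interpolation_projector S P \<Longrightarrow>
       op_norm_ball P > 3 - 4 / (real CARD('n) + 1) + \<epsilon>"
proof -
  let ?n = "CARD('n)"
  define m where "m = (real ?n - 1) / (real ?n + 1)"
  define t where "t = real ?n / (real ?n + 1)"
  have n5: "real ?n \<ge> 5" using assms by simp
  obtain \<delta> where \<delta>: "\<delta> > 0" "m - real ?n * \<delta> > 0"
    and slack: "(2 * (m - real ?n * \<delta>))\<^sup>2 > (1 + (real ?n + 1) * \<delta>)\<^sup>2 *
       (2 + 2 / t * (- 1 / (real ?n + 1) + \<delta> / 2 +
          sqrt (t\<^sup>2 - 2 * t * (t - real ?n * \<delta> / 2) + (t + (real ?n / 2 + 1) * \<delta>)\<^sup>2)))"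
    by (rule small_slack_exists[OF n5, folded m_def t_def])
  have crit: "3 - 4 / (real ?n + 1) = 1 + 2 * m" by (simp add: m_def field_simps)
  have "op_norm_ball P > 3 - 4 / (real ?n + 1) + 2 * \<delta>"
    if P: "interpolation_projector S P" for S :: "(real ^ 'n) set" and P
  proof (rule ccontr)
    assume "\<not> ?thesis"
    then have small: "op_norm_ball P \<le> 1 + 2 * (m + \<delta>)" using crit by simp
    let ?V = "vertices S"
    have S: "nondegenerate_simplex S" and sub: "?V \<subseteq> cball 0 1"
      using P by (auto simp: interpolation_projector_def unit_ball_def)
    note V = vertices_simplex[OF S]
    have "\<forall>v. \<exists>b k. lagrange S v = (\<lambda>x. b \<bullet> x + k)"
      using lagrange(1)[OF S] by (simp add: affine_polys_def)
    then obtain a c where ac: "\<And>v. lagrange S v = (\<lambda>x. a v \<bullet> x + c v)"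
      by metis
    have dual: "a v \<bullet> w + c v = (if w = v then 1 else 0)" if "w \<in> ?V" for v w
      using lagrange(2)[OF S that, of v] by (simp add: ac)
    have csum: "(\<Sum>v\<in>?V. c v) = 1" using sum_lagrange[OF S, of 0] by (simp add: ac)
    have upper: "norm (\<Sum>v\<in>A. a v) - (\<Sum>v\<in>A. c v) \<le> m + \<delta>" if "A \<subseteq> ?V" for A
      using op_norm_ball_ge_gradient[OF P that ac] small by simp
    have single: "norm (a v) - c v \<le> m + \<delta>" if "v \<in> ?V" for v
      using upper[of "{v}"] that by simp
    have cb: "c v \<ge> 1 / (real ?n + 1) - \<delta> / 2" "c v \<le> 1 / (real ?n + 1) + real ?n * \<delta> / 2"
      if "v \<in> ?V" for v
      using constant_terms_nearly_equal[OF V(2,3) sub _ csum single[unfolded m_def] that] dual by auto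
    have "card ?V \<ge> 2" using V(3) assms by simp
    then obtain v w where vw: "v \<in> ?V" "w \<in> ?V" "v \<noteq> w"
      by (meson card_2_iff' obtain_subset_with_card_n subsetD)
    have pair: "norm (a v + a w) - (c v + c w) \<le> m + \<delta>"
      using upper[of "{v, w}"] vw by simp
    have "norm v \<le> 1" "norm w \<le> 1" using sub vw by auto
    moreover have "a v \<bullet> v = 1 - c v" "a v \<bullet> w = - c v" "a w \<bullet> v = - c w" "a w \<bullet> w = 1 - c w"
      using dual[of v v] dual[of w v] dual[of v w] dual[of w w] vw by auto
    ultimately show False
      using pair_bound[of "real ?n" \<delta> v w "a v" "c v" "a w" "c w", folded m_def t_def] slack \<delta> n5
        cb[OF vw(1)] cb(2)[OF vw(2)] single[OF vw(1)] pair by linarith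
  qed
  then show thesis using that[of "2 * \<delta>"] \<delta>(1) by simp
qed

section \<open>Existence of projectors\<close>

text \<open>The infimum of the empty set of reals is an unspecified value, so at least one
  projector is needed; the simplex spanned by \<open>0\<close> and the standard basis provides it.\<close>

lemma interpolation_projector_exists:
  "\<exists>(S :: (real ^ 'n) set) P. interpolation_projector S P"
proof -
  let ?C = "insert 0 Basis :: (real ^ 'n) set"
  have indep: "\<not> affine_dependent ?C"
    using affine_dependent_iff_dependent[of 0 Basis] independent_Basis by auto
  have card: "card ?C = CARD('n) + 1" by simp
  have S: "nondegenerate_simplex (convex hull ?C)"
    unfolding nondegenerate_simplex_def simplex_def using indep card by (intro exI[of _ ?C]) simp
  have "vertices (convex hull ?C) = ?C"
    using extreme_point_of_convex_hull_affine_independent[OF indep] by (auto simp: vertices_def)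
  then have "vertices (convex hull ?C) \<subseteq> unit_ball" by (auto simp: unit_ball_def)
  moreover define P where "P = (\<lambda>f. THE p. p \<in> affine_polys \<and>
    (\<forall>v\<in>vertices (convex hull ?C). p v = (f v :: real)))"
  ultimately have "interpolation_projector (convex hull ?C) P"
    unfolding interpolation_projector_def P_def
    using S theI'[OF affine_interpolation_unique[OF S]] by blast
  then show ?thesis by blast
qed

section \<open>Regular inscribed simplices\<close>

text \<open>All products \<open>v \<bullet> w\<close> of distinct vertices equal a constant \<open>g\<close>.  With \<open>s = \<Sum> v\<close> the
  affine polynomial \<open>s \<bullet> x - (1 + n g)\<close> vanishes at all vertices, hence everywhere, so that
  \<open>g = -1/n\<close>; and this makes \<open>(n v \<bullet> x + 1)/(n + 1)\<close> the Lagrange polynomial of \<open>v\<close>.\<close>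

lemma lagrange_regular_inscribed:
  fixes S :: "(real ^ 'n) set"
  assumes reg: "regular_simplex S" and ins: "inscribed_in_ball S" and v: "v \<in> vertices S"
  shows "lagrange S v x = (real CARD('n) * (v \<bullet> x) + 1) / (real CARD('n) + 1)"
proof -
  let ?V = "vertices S" and ?n = "real CARD('n)"
  have S: "nondegenerate_simplex S" using reg by (simp add: regular_simplex_def)
  note V = vertices_simplex[OF S]
  obtain D where D: "\<And>u w. u \<in> ?V \<Longrightarrow> w \<in> ?V \<Longrightarrow> u \<noteq> w \<Longrightarrow> dist u w = D"
    using reg unfolding regular_simplex_def by metis
  have unit: "u \<bullet> u = 1" if "u \<in> ?V" for u
    using ins that by (auto simp: inscribed_in_ball_def dot_square_norm)
  define g where "g = 1 - D\<^sup>2 / 2"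
  have off: "u \<bullet> w = g" if "u \<in> ?V" "w \<in> ?V" "u \<noteq> w" for u w
  proof -
    have "D\<^sup>2 = (norm (u - w))\<^sup>2" using D[OF that] by (simp add: dist_norm)
    also have "\<dots> = 2 - 2 * (u \<bullet> w)"
      using unit[OF that(1)] unit[OF that(2)]
      by (simp add: power2_norm_eq_inner inner_diff_left inner_diff_right inner_commute)
    finally show ?thesis unfolding g_def by linarith
  qed
  have row: "(\<Sum>u\<in>?V. u) \<bullet> w = 1 + ?n * g" if w: "w \<in> ?V" for w
  proof -
    have "(\<Sum>u\<in>?V. u) \<bullet> w = w \<bullet> w + (\<Sum>u\<in>?V - {w}. u \<bullet> w)"
      unfolding inner_sum_left by (rule sum.remove[OF V(2) w])
    also have "\<dots> = 1 + (\<Sum>u\<in>?V - {w}. g)"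
      using unit[OF w] off w by simp
    finally show ?thesis using V(2,3) w by simp
  qed
  have "(\<lambda>x. (\<Sum>u\<in>?V. u) \<bullet> x + - (1 + ?n * g)) \<in> affine_polys"
    unfolding affine_polys_def by blast
  from affine_poly_eq_lagrange_sum[OF S this, of 0] row
  have g: "1 + ?n * g = 0" by simp
  let ?p = "\<lambda>x. (?n * (v \<bullet> x) + 1) / (?n + 1)"
  have "?p = (\<lambda>x. ((?n / (?n + 1)) *\<^sub>R v) \<bullet> x + 1 / (?n + 1))"
    by (simp add: add_divide_distrib)
  then have p: "?p \<in> affine_polys" unfolding affine_polys_def by blast
  have "?p w = (if w = v then 1 else 0)" if w: "w \<in> ?V" for w
    using unit[OF v] off[OF v w] g by (auto simp: add.commute)
  then have "lagrange S v = ?p"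
    using affine_interpolation_unique[OF S, of "\<lambda>w. if w = v then 1 else 0"] p
      lagrange[OF S] by blast
  then show ?thesis by simp
qed

lemma one_point_regular_norm_le:
  fixes S :: "(real ^ 'n) set"
  assumes reg: "regular_simplex S" and ins: "inscribed_in_ball S" and x: "one_point S x"
  shows "\<exists>P. interpolation_projector S P \<and> op_norm_ball P \<le> 3 - 4 / (real CARD('n) + 1)"
proof -
  let ?V = "vertices S" and ?n = "real CARD('n)"
  have S: "nondegenerate_simplex S" using reg by (simp add: regular_simplex_def)
  have fin: "finite ?V" by (rule vertices_simplex(2)[OF S])
  obtain P v where P: "interpolation_projector S P"
      "op_norm_ball P = (\<Sum>u\<in>?V. \<bar>lagrange S u x\<bar>)"
    and v: "v \<in> ?V" "lagrange S v x < 0"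
    and only: "\<And>u. u \<in> ?V \<Longrightarrow> lagrange S u x < 0 \<Longrightarrow> u = v"
    and xb: "norm x \<le> 1"
    using x unfolding one_point_def by (auto simp: unit_ball_def)
  have "(\<Sum>u\<in>?V. \<bar>lagrange S u x\<bar>) = - lagrange S v x + (\<Sum>u\<in>?V - {v}. \<bar>lagrange S u x\<bar>)"
    using sum.remove[OF fin v(1), of "\<lambda>u. \<bar>lagrange S u x\<bar>"] v(2) by simp
  also have "(\<Sum>u\<in>?V - {v}. \<bar>lagrange S u x\<bar>) = (\<Sum>u\<in>?V - {v}. lagrange S u x)"
    using only by (intro sum.cong) (auto simp: abs_if)
  also have "\<dots> = 1 - lagrange S v x"
    using sum.remove[OF fin v(1), of "\<lambda>u. lagrange S u x"] sum_lagrange[OF S, of x] by simp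
  finally have eq: "op_norm_ball P = 1 - 2 * lagrange S v x" using P(2) by simp
  have "norm v = 1" using ins v(1) by (auto simp: inscribed_in_ball_def)
  then have "v \<bullet> x \<ge> - 1"
    using Cauchy_Schwarz_ineq2[of v x] xb by simp
  then have "?n * (v \<bullet> x) \<ge> - ?n" using mult_left_mono[of "-1" "v \<bullet> x" ?n] by simp
  then have "lagrange S v x \<ge> (- ?n + 1) / (?n + 1)"
    unfolding lagrange_regular_inscribed[OF reg ins v(1)]
    by (intro divide_right_mono) auto
  moreover have "3 - 4 / (?n + 1) = 1 - 2 * ((- ?n + 1) / (?n + 1))"
    by (simp add: field_simps)
  ultimately have "op_norm_ball P \<le> 3 - 4 / (?n + 1)" using eq by linarith
  then show ?thesis using P(1) by blast
qed

section \<open>Projector norms and the critical value\<close>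

theorem mainTheorem5:
  assumes "CARD('n::finite) \<ge> 5"
  shows "(\<forall>S :: (real ^ 'n) set. regular_simplex S \<and> inscribed_in_ball S \<longrightarrow>
            \<not> (\<exists>x. one_point S x)) \<and>
         (\<forall>(S :: (real ^ 'n) set) P. interpolation_projector S P \<longrightarrow>
            op_norm_ball P \<noteq> 3 - 4 / (real CARD('n) + 1)) \<and>
         min_projector_norm TYPE('n) > 3 - 4 / (real CARD('n) + 1)"
proof -
  obtain \<epsilon> where \<epsilon>: "\<epsilon> > 0" and gap: "\<And>(S :: (real ^ 'n) set) P. interpolation_projector S P \<Longrightarrow>
       op_norm_ball P > 3 - 4 / (real CARD('n) + 1) + \<epsilon>"
    using projector_norm_gap[OF assms] by blast
  have "\<not> one_point S x" if "regular_simplex S" "inscribed_in_ball S" for S :: "(real ^ 'n) set" and x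
    using one_point_regular_norm_le[OF that] gap \<epsilon> by fastforce
  moreover have "op_norm_ball P \<noteq> 3 - 4 / (real CARD('n) + 1)"
    if "interpolation_projector S P" for S :: "(real ^ 'n) set" and P
    using gap[OF that] \<epsilon> by simp
  moreover have "min_projector_norm TYPE('n) \<ge> 3 - 4 / (real CARD('n) + 1) + \<epsilon>"
    unfolding min_projector_norm_def
    using interpolation_projector_exists[where 'n = 'n] gap
    by (intro cInf_greatest) (auto intro: less_imp_le)
  ultimately show ?thesis using \<epsilon> by auto
qed

end
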